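(* There exist universal constants $0<c\le C<\infty$ such that for all $n,m\in\mathbb{N}$ and all $a_{i,j}\in\mathbb{R}$, $1\le i\le n$, $1\le j\le m$, setting $$ Q:=\max\Big\{\sum_{i=1}^n\Big(\sum_{j=1}^m a_{i,j}^2\Big)^{1/2},\ \sum_{j=1}^m\Big(\sum_{i=1}^n a_{i,j}^2\Big)^{1/2}\Big\}, $$ both of the quantities $$ \mathsf{E}_\theta\Bigl\|\sum_{i=1}^n\sum_{j=1}^m \theta_{i,j} a_{i,j}\,r_i\otimes r_j\Bigr\|_{L_\infty([0,1]^2)} \quad\text{and}\quad \min_{\theta_{i,j}=\pm 1}\Big\|\sum_{i=1}^n\sum_{j=1}^m \theta_{i,j}a_{i,j}\,r_i\otimes r_j\Big\|_{L_\infty([0,1]^2)} $$ lie between $cQ$ and $CQ$.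
   Context: The Rademacher functions are $r_i(t)=(-1)^{[2^i t]}$, $t\in[0,1]$, $i=1,2,\dots$, where $[x]$ is the integer part of $x$. We write $(r_i\otimes r_j)(u,v)=r_i(u)r_j(v)$ for $(u,v)\in[0,1]^2$. $\mathsf{E}_\theta$ denotes the expectation (uniform average) over all arrangements of signs $\theta_{i,j}=\pm1$, $1\le i\le n$, $1\le j\le m$. *)

theory Defs
  imports "HOL-Probability.Essential_Supremum"
begin

definition rademacher :: "nat \<Rightarrow> real \<Rightarrow> real" where
  "rademacher i t = (-1) powi \<lfloor>2 ^ i * t\<rfloor>"

definition tensor :: "('a \<Rightarrow> real) \<Rightarrow> ('b \<Rightarrow> real) \<Rightarrow> 'a \<times> 'b \<Rightarrow> real"  (infixr \<open>\<otimes>\<^sub>f\<close> 75) where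
  "(f \<otimes>\<^sub>f g) = (\<lambda>(u, v). f u * g v)"

abbreviation unit_square :: "(real \<times> real) measure" where
  "unit_square \<equiv> lebesgue_on ({0..1} \<times> {0..1})"

text \<open>
  The conversion to \<open>real\<close> would send an infinite essential supremum to 0. The lemma
  \<open>Linf_norm_signed_sum\<close> below shows that this never happens for the functions considered here.
\<close>

definition Linf_norm :: "'a measure \<Rightarrow> ('a \<Rightarrow> real) \<Rightarrow> real" where
  "Linf_norm M f = real_of_ereal (esssup M (\<lambda>x. ereal \<bar>f x\<bar>))"

text \<open>
  Sign arrangements are extensional (equal to \<open>undefined\<close> outside the index range), so that
  there are exactly \<open>2 ^ (n * m)\<close> of them.
\<close>

definition sign_arrays :: "nat \<Rightarrow> nat \<Rightarrow> (nat \<Rightarrow> nat \<Rightarrow> real) set" where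
  "sign_arrays n m = ({1..n} \<rightarrow>\<^sub>E ({1..m} \<rightarrow>\<^sub>E {-1, 1}))"

definition expectation_signs :: "nat \<Rightarrow> nat \<Rightarrow> ((nat \<Rightarrow> nat \<Rightarrow> real) \<Rightarrow> real) \<Rightarrow> real" where
  "expectation_signs n m F = (\<Sum>\<theta>\<in>sign_arrays n m. F \<theta>) / real (card (sign_arrays n m))"

definition signed_sum ::
  "nat \<Rightarrow> nat \<Rightarrow> (nat \<Rightarrow> nat \<Rightarrow> real) \<Rightarrow> (nat \<Rightarrow> nat \<Rightarrow> real) \<Rightarrow> real \<times> real \<Rightarrow> real" where
  "signed_sum n m a \<theta> =
     (\<lambda>x. \<Sum>i=1..n. \<Sum>j=1..m. \<theta> i j * a i j * (rademacher i \<otimes>\<^sub>f rademacher j) x)"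

definition mixed_norm :: "nat \<Rightarrow> nat \<Rightarrow> (nat \<Rightarrow> nat \<Rightarrow> real) \<Rightarrow> real" where
  "mixed_norm n m a =
     max (\<Sum>i=1..n. sqrt (\<Sum>j=1..m. (a i j)\<^sup>2)) (\<Sum>j=1..m. sqrt (\<Sum>i=1..n. (a i j)\<^sup>2))"

lemma finite_sign_arrays: "finite (sign_arrays n m)"
  unfolding sign_arrays_def by (intro finite_PiE) auto

lemma card_sign_arrays: "card (sign_arrays n m) = 2 ^ (n * m)"
  unfolding sign_arrays_def by (simp add: card_PiE power_mult[symmetric] mult.commute numeral_2_eq_2)

lemma abs_rademacher: "\<bar>rademacher i t\<bar> = 1"
  unfolding rademacher_def by (simp add: power_int_abs)

lemma rademacher_measurable [measurable]: "rademacher i \<in> borel_measurable borel"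
  unfolding rademacher_def by measurable

lemma signed_sum_measurable: "signed_sum n m a \<theta> \<in> borel_measurable unit_square"
proof -
  have "signed_sum n m a \<theta> \<in> borel_measurable borel"
    unfolding signed_sum_def tensor_def case_prod_beta borel_prod[symmetric] by measurable
  then have "signed_sum n m a \<theta> \<in> borel_measurable lebesgue"
    by (intro measurable_completion) (simp add: measurable_lborel1)
  then show ?thesis
    by (rule measurable_restrict_space1)
qed

lemma Linf_norm_signed_sum:
  "ereal (Linf_norm unit_square (signed_sum n m a \<theta>)) =
     esssup unit_square (\<lambda>x. ereal \<bar>signed_sum n m a \<theta> x\<bar>)"
proof -
  let ?f = "\<lambda>x. ereal \<bar>signed_sum n m a \<theta> x\<bar>"
  have meas: "?f \<in> borel_measurable unit_square"
    using signed_sum_measurable by measurable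
  have "\<bar>signed_sum n m a \<theta> x\<bar> \<le> (\<Sum>i=1..n. \<Sum>j=1..m. \<bar>\<theta> i j * a i j\<bar>)" for x
    unfolding signed_sum_def tensor_def case_prod_beta
    by (intro order_trans[OF sum_abs] sum_mono) (simp add: abs_mult abs_rademacher)
  then have upper: "esssup unit_square ?f \<le> ereal (\<Sum>i=1..n. \<Sum>j=1..m. \<bar>\<theta> i j * a i j\<bar>)"
    by (intro esssup_I[OF meas]) simp
  have "({0..1} \<times> {0..1} :: (real \<times> real) set) = cbox (0, 0) (1, 1)"
    by (auto simp: cbox_Pair_eq)
  then have "emeasure unit_square (space unit_square) \<noteq> 0"
    by (simp add: emeasure_restrict_space emeasure_lborel_cbox_eq Basis_prod_def inner_prod_def
        prod.union_disjoint prod.reindex inj_on_def)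
  then have "0 = esssup unit_square (\<lambda>x. 0 :: ereal)"
    by (simp add: esssup_const)
  also have "\<dots> \<le> esssup unit_square ?f"
    by (rule esssup_mono) auto
  finally show ?thesis
    unfolding Linf_norm_def using upper
    by (cases "esssup unit_square ?f") auto
qed

end

theory Submission
  imports Defs
begin

text \<open>
  Every pair of sign vectors is realised by the Rademacher functions on a product of dyadic
  intervals, so the \<open>L\<^sub>\<infinity>\<close> norm of \<open>\<Sum> b\<^sub>i\<^sub>j r\<^sub>i \<otimes> r\<^sub>j\<close> is the maximum of
  \<open>\<bar>\<Sum> b\<^sub>i\<^sub>j x\<^sub>i y\<^sub>j\<bar>\<close> over signs \<open>x\<close>, \<open>y\<close>
  (\<open>Linf_norm_signed_sum_eq\<close>). Maximising over \<open>x\<close> first turns this into the maximum over \<open>y\<close>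
  of \<open>\<Sum>\<^sub>i \<bar>\<Sum>\<^sub>j b\<^sub>i\<^sub>j y\<^sub>j\<bar>\<close>, the norm of the matrix \<open>b\<close> as an operator from
  the supremum norm to the sum norm. What remains is a statement about this matrix norm, with
  \<open>b\<^sub>i\<^sub>j = \<theta>\<^sub>i\<^sub>j a\<^sub>i\<^sub>j\<close>.

  The lower bound holds for every \<open>\<theta>\<close>. The maximum over \<open>y\<close> is at least the average over \<open>y\<close>, and
  Khinchin's inequality bounds the average of each row from below by a multiple of its
  Euclidean norm, which does not depend on \<open>\<theta>\<close>. The norm is invariant under transposition, which
  gives the same bound with columns (\<open>inf_one_norm_signs_lower\<close>).

  The upper bound holds on average over \<open>\<theta>\<close> (\<open>average_inf_one_norm_le\<close>). For a fixed \<open>y\<close> the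
  absolute row sums have means at most the Euclidean norms of the rows, so the issue is the
  fluctuation of \<open>\<Sum>\<^sub>i \<bar>\<Sum>\<^sub>j \<theta>\<^sub>i\<^sub>j a\<^sub>i\<^sub>j y\<^sub>j\<bar>\<close> uniformly in \<open>y\<close>. Symmetrising a row and then
  using that the absolute value is a contraction replaces its term by twice the
  same linear form without absolute value, at the price of one row norm. After this has been
  done for all rows, what is maximised is linear in \<open>y\<close>, and the maximum is twice
  \<open>\<Sum>\<^sub>j \<bar>\<Sum>\<^sub>i \<theta>\<^sub>i\<^sub>j a\<^sub>i\<^sub>j\<bar>\<close>. By the Cauchy-Schwarz inequality its mean is at most twice the sum
  of the column norms. Since the minimum over \<open>\<theta>\<close> is at most the mean, both quantities lie
  between \<open>9/16\<close> and \<open>3\<close> times the mixed norm.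
\<close>

section \<open>Averages over finite sets\<close>

definition average :: "'a set \<Rightarrow> ('a \<Rightarrow> real) \<Rightarrow> real" where
  "average A F = (\<Sum>x\<in>A. F x) / real (card A)"

lemma average_mono: "(\<And>x. x \<in> A \<Longrightarrow> F x \<le> G x) \<Longrightarrow> average A F \<le> average A G"
  unfolding average_def by (intro divide_right_mono sum_mono) auto

lemma average_cong: "(\<And>x. x \<in> A \<Longrightarrow> F x = G x) \<Longrightarrow> average A F = average A G"
  unfolding average_def by simp

lemma average_const: "finite A \<Longrightarrow> A \<noteq> {} \<Longrightarrow> average A (\<lambda>x. c) = c"
  unfolding average_def by simp

lemma average_add: "average A (\<lambda>x. F x + G x) = average A F + average A G"
  unfolding average_def by (simp add: sum.distrib add_divide_distrib)

lemma average_diff: "average A (\<lambda>x. F x - G x) = average A F - average A G"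
  unfolding average_def by (simp add: sum_subtractf diff_divide_distrib)

lemma average_cmult: "average A (\<lambda>x. c * F x) = c * average A F"
  unfolding average_def by (simp add: sum_distrib_left)

lemma average_sum: "average A (\<lambda>x. \<Sum>i\<in>I. F i x) = (\<Sum>i\<in>I. average A (F i))"
  unfolding average_def by (subst sum.swap) (simp add: sum_divide_distrib)

lemma average_swap:
  "average A (\<lambda>x. average B (F x)) = average B (\<lambda>y. average A (\<lambda>x. F x y))"
  unfolding average_def sum_divide_distrib[symmetric]
  by (subst sum.swap) (simp add: sum_divide_distrib mult.commute)

lemma average_bij: "bij_betw g A A \<Longrightarrow> average A (\<lambda>x. F (g x)) = average A F"
  unfolding average_def by (simp add: sum.reindex_bij_betw)

lemma average_le_const:
  assumes "finite A" "A \<noteq> {}" "\<And>x. x \<in> A \<Longrightarrow> F x \<le> c"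
  shows "average A F \<le> c"
  using average_mono[of A F "\<lambda>x. c"] assms by (simp add: average_const)

lemma const_le_average:
  assumes "finite A" "A \<noteq> {}" "\<And>x. x \<in> A \<Longrightarrow> c \<le> F x"
  shows "c \<le> average A F"
  using average_mono[of A "\<lambda>x. c" F] assms by (simp add: average_const)

lemma average_abs_le_sqrt: "average A (\<lambda>x. \<bar>F x\<bar>) \<le> sqrt (average A (\<lambda>x. (F x)\<^sup>2))"
proof (cases "finite A \<and> A \<noteq> {}")
  case True
  have "(\<Sum>x\<in>A. \<bar>F x\<bar>)\<^sup>2 \<le> (\<Sum>x\<in>A. (F x)\<^sup>2) * real (card A)"
    using sum_squared_le_sum_of_squares[of "\<lambda>x. \<bar>F x\<bar>" A] by simp
  with True show ?thesis
    unfolding average_def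
    by (intro real_le_rsqrt) (auto simp: power_divide power2_eq_square divide_simps card_gt_0_iff)
qed (auto simp: average_def)

text \<open>
  Coordinates of a uniformly chosen function are independent. This form of Fubini's theorem drives
  all the inductions over an index set.
\<close>

lemma average_PiE_insert:
  assumes "k \<notin> I"
  shows "average (insert k I \<rightarrow>\<^sub>E S) F = average S (\<lambda>x. average (I \<rightarrow>\<^sub>E S) (\<lambda>\<theta>. F (\<theta>(k := x))))"
proof -
  let ?g = "\<lambda>(x, \<theta>). \<theta>(k := x)"
  have eq: "(insert k I \<rightarrow>\<^sub>E S) = ?g ` (S \<times> (I \<rightarrow>\<^sub>E S))"
    by (rule PiE_insert_eq)
  have inj: "inj_on ?g (S \<times> (I \<rightarrow>\<^sub>E S))"
    using assms by (rule inj_combinator)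
  show ?thesis
    unfolding average_def eq sum.reindex[OF inj] card_image[OF inj] sum_divide_distrib[symmetric]
    by (simp add: sum.cartesian_product card_cartesian_product case_prod_beta' mult.commute)
qed

text \<open>
  The mixed terms vanish because the summands are independent and have mean zero. The coordinate
  space \<open>S\<close> is general, so that the lemma applies both to single signs and to whole rows of signs.
\<close>

lemma average_square_independent_sum:
  assumes "finite I" "finite S" "S \<noteq> {}"
    and "\<And>i. i \<in> I \<Longrightarrow> average S (f i) = 0"
  shows "average (I \<rightarrow>\<^sub>E S) (\<lambda>\<theta>. (\<Sum>i\<in>I. f i (\<theta> i))\<^sup>2) = (\<Sum>i\<in>I. average S (\<lambda>x. (f i x)\<^sup>2))"
  using assms(1,4)
proof (induction I rule: finite_induct)
  case empty
  then show ?case by (simp add: average_def)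
next
  case (insert k I)
  let ?T = "\<lambda>\<theta>. \<Sum>i\<in>I. f i (\<theta> i)"
  have fin: "finite (I \<rightarrow>\<^sub>E S)" "(I \<rightarrow>\<^sub>E S) \<noteq> {}"
    using insert.hyps assms(2,3) by (auto intro!: finite_PiE simp: PiE_eq_empty_iff)
  have upd: "(\<Sum>i\<in>insert k I. f i ((\<theta>(k := x)) i)) = f k x + ?T \<theta>" for x \<theta>
    using insert.hyps by (auto intro!: sum.cong)
  have "average S (\<lambda>x. (f k x + ?T \<theta>)\<^sup>2) = average S (\<lambda>x. (f k x)\<^sup>2) + (?T \<theta>)\<^sup>2" for \<theta>
  proof -
    have "average S (\<lambda>x. (f k x + ?T \<theta>)\<^sup>2)
        = average S (\<lambda>x. (f k x)\<^sup>2 + (2 * ?T \<theta>) * f k x + (?T \<theta>)\<^sup>2)"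
      by (simp add: power2_sum algebra_simps)
    also have "\<dots> = average S (\<lambda>x. (f k x)\<^sup>2) + (?T \<theta>)\<^sup>2"
      using insert.prems[of k] assms(2,3)
      by (simp add: average_add average_cmult average_const)
    finally show ?thesis .
  qed
  then show ?case
    unfolding average_PiE_insert[OF insert.hyps(2)] upd
    using insert fin by (subst average_swap) (simp add: average_add average_const)
qed

section \<open>Sign vectors and Khinchin's inequality\<close>

abbreviation signs :: "'a set \<Rightarrow> ('a \<Rightarrow> real) set" where
  "signs J \<equiv> J \<rightarrow>\<^sub>E {-1, 1}"

lemma signs_finite_nonempty: "finite J \<Longrightarrow> finite (signs J)" "signs J \<noteq> {}"
  by (auto intro!: finite_PiE simp: PiE_eq_empty_iff)

lemma average_pair: "average {-1, 1 :: real} F = (F (-1) + F 1) / 2"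
  by (simp add: average_def)

lemma average_square_signed_sum:
  assumes "finite J"
  shows "average (signs J) (\<lambda>x. (\<Sum>j\<in>J. x j * b j)\<^sup>2) = (\<Sum>j\<in>J. (b j)\<^sup>2)"
  using average_square_independent_sum[of J "{-1, 1}" "\<lambda>j s. s * b j"] assms
  by (simp add: average_pair power_mult_distrib)

text \<open>
  In the fourth power of \<open>T \<plusminus> b\<^sub>k\<close> the odd terms cancel on average. The remaining cross term
  \<open>6 b\<^sub>k\<^sup>2 T\<^sup>2\<close> is exactly the one in \<open>3 (b\<^sub>k\<^sup>2 + v)\<^sup>2\<close>, where \<open>v\<close> is the mean of \<open>T\<^sup>2\<close>, so the
  constant \<open>3\<close> is preserved.
\<close>

lemma average_fourth_power_signed_sum:
  assumes "finite J"
  shows "average (signs J) (\<lambda>x. (\<Sum>j\<in>J. x j * b j) ^ 4) \<le> 3 * (\<Sum>j\<in>J. (b j)\<^sup>2)\<^sup>2"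
  using assms
proof (induction J rule: finite_induct)
  case empty
  then show ?case by (simp add: average_def)
next
  case (insert k J)
  let ?T = "\<lambda>x. \<Sum>j\<in>J. x j * b j" and ?v = "\<Sum>j\<in>J. (b j)\<^sup>2"
  have fin: "finite (signs J)" "signs J \<noteq> {}"
    using insert.hyps signs_finite_nonempty by auto
  have upd: "(\<Sum>j\<in>insert k J. (x(k := s)) j * b j) = s * b k + ?T x" for x s
    using insert.hyps by (auto intro!: sum.cong)
  have "average {-1, 1} (\<lambda>s. (s * b k + ?T x) ^ 4)
      = (?T x) ^ 4 + (6 * (b k)\<^sup>2) * (?T x)\<^sup>2 + (b k) ^ 4" for x
    unfolding average_pair by (simp add: power2_eq_square power4_eq_xxxx algebra_simps)
  then have "average (signs (insert k J)) (\<lambda>x. (\<Sum>j\<in>insert k J. x j * b j) ^ 4)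
      = average (signs J) (\<lambda>x. (?T x) ^ 4) + (6 * (b k)\<^sup>2) * ?v + (b k) ^ 4"
    unfolding average_PiE_insert[OF insert.hyps(2)] upd
    using insert.hyps fin
    by (subst average_swap)
      (simp add: average_add average_const average_cmult average_square_signed_sum)
  also have "\<dots> \<le> 3 * ?v\<^sup>2 + (6 * (b k)\<^sup>2) * ?v + 3 * (b k) ^ 4"
    using insert.IH by (intro add_mono) auto
  also have "\<dots> = 3 * ((b k)\<^sup>2 + ?v)\<^sup>2"
    by (simp add: power2_eq_square power4_eq_xxxx algebra_simps)
  finally show ?case
    using insert.hyps by simp
qed

text \<open>
  A random variable whose fourth moment is comparable to its squared second moment cannot be
  small in mean. Quantitatively, \<open>\<bar>x\<bar> \<ge> 3/4 x\<^sup>2 - 1/16 x\<^sup>4\<close> for all real \<open>x\<close>; taking means of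
  both sides for the sum divided by its standard deviation gives \<open>3/4 - 3/16 = 9/16\<close>.
\<close>

lemma khinchin_lower:
  assumes "finite J"
  shows "9/16 * sqrt (\<Sum>j\<in>J. (b j)\<^sup>2) \<le> average (signs J) (\<lambda>x. \<bar>\<Sum>j\<in>J. x j * b j\<bar>)"
proof -
  define \<sigma> where "\<sigma> = sqrt (\<Sum>j\<in>J. (b j)\<^sup>2)"
  let ?T = "\<lambda>x. \<Sum>j\<in>J. x j * b j"
  have fin: "finite (signs J)" "signs J \<noteq> {}"
    using assms signs_finite_nonempty by auto
  have sq: "(\<Sum>j\<in>J. (b j)\<^sup>2) = \<sigma>\<^sup>2"
    unfolding \<sigma>_def by (simp add: sum_nonneg)
  have "9/16 * \<sigma> \<le> average (signs J) (\<lambda>x. \<bar>?T x\<bar>)"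
  proof (cases "\<sigma> = 0")
    case True
    then show ?thesis
      using const_le_average[OF fin, of 0 "\<lambda>x. \<bar>?T x\<bar>"] by simp
  next
    case False
    moreover have "\<sigma> \<ge> 0"
      unfolding \<sigma>_def by (simp add: sum_nonneg)
    ultimately have pos: "\<sigma> > 0" by simp
    have pointwise: "(3 / (4 * \<sigma>)) * t\<^sup>2 - (1 / (16 * \<sigma> ^ 3)) * t ^ 4 \<le> \<bar>t\<bar>" for t :: real
    proof -
      define x where "x = \<bar>t\<bar> / \<sigma>"
      have t: "\<bar>t\<bar> = x * \<sigma>" and x: "x \<ge> 0"
        using pos by (auto simp: x_def)
      \<comment> \<open>The polynomial \<open>x\<^sup>3 - 12 x + 16\<close> has the double root \<open>2\<close>.\<close>
      have "0 \<le> x * ((x - 2)\<^sup>2 * (x + 4))"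
        using x by (intro mult_nonneg_nonneg) auto
      then have "3/4 * x\<^sup>2 - 1/16 * x ^ 4 \<le> x"
        by (simp add: power2_eq_square power4_eq_xxxx algebra_simps)
      then have "(3/4 * x\<^sup>2 - 1/16 * x ^ 4) * \<sigma> \<le> x * \<sigma>"
        using pos by (intro mult_right_mono) auto
      moreover have "t\<^sup>2 = (x * \<sigma>)\<^sup>2" "t ^ 4 = (x * \<sigma>) ^ 4"
        by (simp_all flip: t)
      moreover have "(3 / (4 * \<sigma>)) * (x * \<sigma>)\<^sup>2 - (1 / (16 * \<sigma> ^ 3)) * (x * \<sigma>) ^ 4
          = (3/4 * x\<^sup>2 - 1/16 * x ^ 4) * \<sigma>"
        using pos by (simp add: power2_eq_square power3_eq_cube power4_eq_xxxx field_simps)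
      ultimately show ?thesis
        using t by simp
    qed
    have "9/16 * \<sigma> = (3 / (4 * \<sigma>)) * \<sigma>\<^sup>2 - (1 / (16 * \<sigma> ^ 3)) * (3 * (\<sigma>\<^sup>2)\<^sup>2)"
      using pos by (simp add: power2_eq_square power3_eq_cube field_simps)
    also have "\<dots> \<le> (3 / (4 * \<sigma>)) * average (signs J) (\<lambda>x. (?T x)\<^sup>2)
        - (1 / (16 * \<sigma> ^ 3)) * average (signs J) (\<lambda>x. (?T x) ^ 4)"
      using average_fourth_power_signed_sum[OF assms, of b] pos
      unfolding average_square_signed_sum[OF assms] sq
      by (intro diff_left_mono mult_left_mono) auto
    also have "\<dots> = average (signs J)
        (\<lambda>x. (3 / (4 * \<sigma>)) * (?T x)\<^sup>2 - (1 / (16 * \<sigma> ^ 3)) * (?T x) ^ 4)"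
      by (simp only: average_diff average_cmult)
    also have "\<dots> \<le> average (signs J) (\<lambda>x. \<bar>?T x\<bar>)"
      by (intro average_mono pointwise)
    finally show ?thesis .
  qed
  then show ?thesis
    unfolding \<sigma>_def .
qed

section \<open>The norm of a matrix as an operator from supremum norm to sum norm\<close>

definition inf_one_norm :: "'i set \<Rightarrow> 'j set \<Rightarrow> ('i \<Rightarrow> 'j \<Rightarrow> real) \<Rightarrow> real" where
  "inf_one_norm I J b = (MAX y\<in>signs J. \<Sum>i\<in>I. \<bar>\<Sum>j\<in>J. y j * b i j\<bar>)"

lemma inf_one_norm_ge:
  "finite J \<Longrightarrow> y \<in> signs J \<Longrightarrow> (\<Sum>i\<in>I. \<bar>\<Sum>j\<in>J. y j * b i j\<bar>) \<le> inf_one_norm I J b"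
  unfolding inf_one_norm_def
  by (rule Max_ge[OF finite_imageI imageI[where f = "\<lambda>y. \<Sum>i\<in>I. \<bar>\<Sum>j\<in>J. y j * b i j\<bar>"]])
    (auto intro: signs_finite_nonempty)

lemma inf_one_norm_attained:
  assumes "finite J"
  obtains y where "y \<in> signs J" "inf_one_norm I J b = (\<Sum>i\<in>I. \<bar>\<Sum>j\<in>J. y j * b i j\<bar>)"
proof -
  have "inf_one_norm I J b \<in> (\<lambda>y. \<Sum>i\<in>I. \<bar>\<Sum>j\<in>J. y j * b i j\<bar>) ` signs J"
    unfolding inf_one_norm_def using assms by (intro Max_in) (auto simp: signs_finite_nonempty)
  then show ?thesis using that by blast
qed

lemma sum_abs_attained:
  obtains x where "x \<in> signs I" "(\<Sum>i\<in>I. \<bar>c i\<bar>) = (\<Sum>i\<in>I. x i * c i)"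
proof
  let ?x = "\<lambda>i\<in>I. if c i \<ge> 0 then 1 else -1 :: real"
  show "?x \<in> signs I" by auto
  show "(\<Sum>i\<in>I. \<bar>c i\<bar>) = (\<Sum>i\<in>I. ?x i * c i)" by (intro sum.cong) auto
qed

lemma signed_sum_le_sum_abs:
  assumes "x \<in> signs I"
  shows "\<bar>\<Sum>i\<in>I. x i * c i\<bar> \<le> (\<Sum>i\<in>I. \<bar>c i\<bar>)"
proof -
  have "\<bar>x i * c i\<bar> = \<bar>c i\<bar>" if "i \<in> I" for i
    using PiE_mem[OF assms that] by (auto simp: abs_mult)
  then show ?thesis
    using sum_abs[of "\<lambda>i. x i * c i" I] by simp
qed

text \<open>
  The bilinear form \<open>\<Sum> b\<^sub>i\<^sub>j x\<^sub>i y\<^sub>j\<close> can be maximised over the two sign vectors in either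
  order. Applied twice, this inequality is the equality of the two norms.
\<close>

lemma inf_one_norm_le_transpose:
  assumes "finite I" "finite J"
  shows "inf_one_norm I J b \<le> inf_one_norm J I (\<lambda>j i. b i j)"
proof -
  obtain y where y: "y \<in> signs J" "inf_one_norm I J b = (\<Sum>i\<in>I. \<bar>\<Sum>j\<in>J. y j * b i j\<bar>)"
    by (rule inf_one_norm_attained[OF assms(2)])
  obtain x where x: "x \<in> signs I"
    "(\<Sum>i\<in>I. \<bar>\<Sum>j\<in>J. y j * b i j\<bar>) = (\<Sum>i\<in>I. x i * (\<Sum>j\<in>J. y j * b i j))"
    by (rule sum_abs_attained)
  have "inf_one_norm I J b = (\<Sum>j\<in>J. y j * (\<Sum>i\<in>I. x i * b i j))"
    unfolding y x sum_distrib_left by (subst sum.swap) (simp add: mult_ac)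
  also have "\<dots> \<le> (\<Sum>j\<in>J. \<bar>\<Sum>i\<in>I. x i * b i j\<bar>)"
    by (rule abs_le_D1[OF signed_sum_le_sum_abs[OF y(1)]])
  also have "\<dots> \<le> inf_one_norm J I (\<lambda>j i. b i j)"
    using inf_one_norm_ge[OF assms(1) x(1)] .
  finally show ?thesis .
qed

lemma inf_one_norm_lower:
  assumes "finite I" "finite J"
  shows "9/16 * (\<Sum>i\<in>I. sqrt (\<Sum>j\<in>J. (b i j)\<^sup>2)) \<le> inf_one_norm I J b"
proof -
  have "9/16 * (\<Sum>i\<in>I. sqrt (\<Sum>j\<in>J. (b i j)\<^sup>2))
      \<le> (\<Sum>i\<in>I. average (signs J) (\<lambda>y. \<bar>\<Sum>j\<in>J. y j * b i j\<bar>))"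
    unfolding sum_distrib_left by (intro sum_mono khinchin_lower assms)
  also have "\<dots> = average (signs J) (\<lambda>y. \<Sum>i\<in>I. \<bar>\<Sum>j\<in>J. y j * b i j\<bar>)"
    by (simp add: average_sum)
  also have "\<dots> \<le> inf_one_norm I J b"
    using assms by (intro average_le_const inf_one_norm_ge signs_finite_nonempty)
  finally show ?thesis .
qed

section \<open>Random signs\<close>

lemma le_Max_image: "finite Y \<Longrightarrow> y \<in> Y \<Longrightarrow> F y \<le> (MAX y\<in>Y. F y)"
  by (rule Max_ge[OF finite_imageI imageI])

text \<open>
  The key step: one random row \<open>x\<close> loses its absolute value. The family \<open>h\<close> stands for the
  contribution of all other rows, and \<open>neg\<close> for the symmetry of the distribution of \<open>x\<close>.

  Subtracting the mean of an independent copy \<open>\<bar>t x' y\<bar>\<close> costs at most \<open>r\<close>. The difference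
  \<open>h y + \<bar>t x y\<bar> - \<bar>t x' y\<bar>\<close> is the mean of \<open>h y + 2 \<bar>t x y\<bar>\<close> and \<open>h y - 2 \<bar>t x' y\<bar>\<close>,
  which are bounded by their separate maxima \<open>P x\<close> and \<open>N x'\<close>. After averaging, \<open>x\<close> and \<open>x'\<close>
  need not be distinguished, and \<open>P x + N x\<close> is controlled by \<open>M x + M (neg x)\<close>, both of whose
  terms have the same mean.
\<close>

lemma average_Max_abs_le:
  fixes h :: "'y \<Rightarrow> real" and t :: "'x \<Rightarrow> 'y \<Rightarrow> real"
  assumes S: "finite S" "S \<noteq> {}" and Y: "finite Y" "Y \<noteq> {}"
    and neg: "bij_betw neg S S" "\<And>x y. x \<in> S \<Longrightarrow> y \<in> Y \<Longrightarrow> t (neg x) y = - t x y"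
    and r: "\<And>y. y \<in> Y \<Longrightarrow> average S (\<lambda>x. \<bar>t x y\<bar>) \<le> r"
  shows "average S (\<lambda>x. MAX y\<in>Y. h y + \<bar>t x y\<bar>) \<le> r + average S (\<lambda>x. MAX y\<in>Y. h y + 2 * t x y)"
proof -
  define M where "M x = (MAX y\<in>Y. h y + 2 * t x y)" for x
  define P where "P x = (MAX y\<in>Y. h y + 2 * \<bar>t x y\<bar>)" for x
  define N where "N x = (MAX y\<in>Y. h y - 2 * \<bar>t x y\<bar>)" for x
  have M: "h y + 2 * t x y \<le> M x" and P: "h y + 2 * \<bar>t x y\<bar> \<le> P x"
    and N: "h y - 2 * \<bar>t x y\<bar> \<le> N x" if "y \<in> Y" for x y
    unfolding M_def P_def N_def
    using le_Max_image[OF Y(1) that, of "\<lambda>y. h y + 2 * t x y"]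
      le_Max_image[OF Y(1) that, of "\<lambda>y. h y + 2 * \<bar>t x y\<bar>"]
      le_Max_image[OF Y(1) that, of "\<lambda>y. h y - 2 * \<bar>t x y\<bar>"]
    by - assumption+
  have contraction: "P x + N x \<le> M x + M (neg x)" if x: "x \<in> S" for x
  proof -
    have "P x \<in> (\<lambda>y. h y + 2 * \<bar>t x y\<bar>) ` Y" "N x \<in> (\<lambda>y. h y - 2 * \<bar>t x y\<bar>) ` Y"
      unfolding P_def N_def using Y by (intro Max_in; simp)+
    then obtain y z where yz: "y \<in> Y" "z \<in> Y"
      "P x = h y + 2 * \<bar>t x y\<bar>" "N x = h z - 2 * \<bar>t x z\<bar>"
      by blast
    \<comment> \<open>The sign of \<open>t x y\<close> decides which of \<open>M x\<close> and \<open>M (neg x)\<close> bounds \<open>P x\<close>; the other one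
      bounds \<open>N x\<close>, since \<open>- \<bar>s\<bar>\<close> lies below both \<open>s\<close> and \<open>- s\<close>.\<close>
    show ?thesis
      using M[OF yz(1), of x] M[OF yz(1), of "neg x"] M[OF yz(2), of x] M[OF yz(2), of "neg x"]
        neg(2)[OF x yz(1)] neg(2)[OF x yz(2)] yz(3,4)
      by (cases "t x y \<ge> 0") linarith+
  qed
  have symmetrise: "(MAX y\<in>Y. h y + \<bar>t x y\<bar>) \<le> r + (P x + average S N) / 2" for x
  proof -
    have "h y + \<bar>t x y\<bar> \<le> r + (P x + average S N) / 2" if y: "y \<in> Y" for y
    proof -
      have "h y - 2 * average S (\<lambda>x. \<bar>t x y\<bar>) = average S (\<lambda>x. h y - 2 * \<bar>t x y\<bar>)"
        using S by (simp add: average_diff average_cmult average_const)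
      also have "\<dots> \<le> average S N"
        using N[OF y] by (intro average_mono)
      finally show ?thesis
        using P[OF y, of x] r[OF y] by (simp add: field_simps)
    qed
    then show ?thesis using Y by (auto intro!: Max.boundedI)
  qed
  have "average S (\<lambda>x. MAX y\<in>Y. h y + \<bar>t x y\<bar>) \<le> average S (\<lambda>x. r + (P x + average S N) / 2)"
    by (intro average_mono symmetrise)
  also have "\<dots> = r + average S (\<lambda>x. P x + N x) / 2"
    using S average_cmult[of S "1/2"] by (simp add: average_add average_const add_divide_distrib)
  also have "\<dots> \<le> r + average S (\<lambda>x. M x + M (neg x)) / 2"
    using average_mono[OF contraction, of S] by simp
  also have "\<dots> = r + average S M"
    using average_bij[OF neg(1), of M] by (simp add: average_add)
  finally show ?thesis
    unfolding M_def .
qed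

text \<open>
  Independent rows are treated one after the other. The family \<open>h\<close> must be arbitrary in the
  induction: for the rows of \<open>I\<close> it absorbs \<open>\<bar>t k x y\<bar>\<close> with the row \<open>k\<close> fixed, and for
  the row \<open>k\<close> it absorbs the linear terms that the rows of \<open>I\<close> have become.
\<close>

lemma average_Max_sum_abs_le:
  fixes h :: "'y \<Rightarrow> real" and t :: "'i \<Rightarrow> 'x \<Rightarrow> 'y \<Rightarrow> real"
  assumes S: "finite S" "S \<noteq> {}" and Y: "finite Y" "Y \<noteq> {}"
    and neg: "bij_betw neg S S"
    and I: "finite I"
    and odd: "\<And>i x y. i \<in> I \<Longrightarrow> x \<in> S \<Longrightarrow> y \<in> Y \<Longrightarrow> t i (neg x) y = - t i x y"
    and r: "\<And>i y. i \<in> I \<Longrightarrow> y \<in> Y \<Longrightarrow> average S (\<lambda>x. \<bar>t i x y\<bar>) \<le> r i"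
  shows "average (I \<rightarrow>\<^sub>E S) (\<lambda>\<theta>. MAX y\<in>Y. h y + (\<Sum>i\<in>I. \<bar>t i (\<theta> i) y\<bar>))
    \<le> (\<Sum>i\<in>I. r i) + average (I \<rightarrow>\<^sub>E S) (\<lambda>\<theta>. MAX y\<in>Y. h y + 2 * (\<Sum>i\<in>I. t i (\<theta> i) y))"
  using I odd r
proof (induction I arbitrary: h rule: finite_induct)
  case empty
  then show ?case by simp
next
  case (insert k I)
  have fin: "finite (I \<rightarrow>\<^sub>E S)" "(I \<rightarrow>\<^sub>E S) \<noteq> {}"
    using insert.hyps S by (auto intro!: finite_PiE simp: PiE_eq_empty_iff)
  have upd: "(\<Sum>i\<in>insert k I. \<bar>t i ((\<theta>(k := x)) i) y\<bar>) = \<bar>t k x y\<bar> + (\<Sum>i\<in>I. \<bar>t i (\<theta> i) y\<bar>)"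
    "(\<Sum>i\<in>insert k I. t i ((\<theta>(k := x)) i) y) = t k x y + (\<Sum>i\<in>I. t i (\<theta> i) y)" for \<theta> x y
    using insert.hyps by (auto intro!: sum.cong)
  let ?T = "\<lambda>\<theta> y. \<Sum>i\<in>I. t i (\<theta> i) y"
  have "average S (\<lambda>x. average (I \<rightarrow>\<^sub>E S)
        (\<lambda>\<theta>. MAX y\<in>Y. h y + (\<bar>t k x y\<bar> + (\<Sum>i\<in>I. \<bar>t i (\<theta> i) y\<bar>))))
      \<le> average S (\<lambda>x. (\<Sum>i\<in>I. r i) + average (I \<rightarrow>\<^sub>E S)
        (\<lambda>\<theta>. MAX y\<in>Y. (h y + \<bar>t k x y\<bar>) + 2 * ?T \<theta> y))"
    using insert.IH[of "\<lambda>y. h y + \<bar>t k _ y\<bar>"] insert.prems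
    by (intro average_mono) (simp add: add.assoc)
  also have "\<dots> = (\<Sum>i\<in>I. r i) + average (I \<rightarrow>\<^sub>E S) (\<lambda>\<theta>. average S
        (\<lambda>x. MAX y\<in>Y. (h y + 2 * ?T \<theta> y) + \<bar>t k x y\<bar>))"
    using S by (subst average_swap) (simp add: average_add average_const add_ac)
  also have "\<dots> \<le> (\<Sum>i\<in>I. r i) + average (I \<rightarrow>\<^sub>E S) (\<lambda>\<theta>. r k + average S
        (\<lambda>x. MAX y\<in>Y. (h y + 2 * ?T \<theta> y) + 2 * t k x y))"
    using insert.prems
    by (intro add_left_mono average_mono average_Max_abs_le[OF S Y neg]) auto
  also have "\<dots> = (\<Sum>i\<in>insert k I. r i) + average S (\<lambda>x. average (I \<rightarrow>\<^sub>E S)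
        (\<lambda>\<theta>. MAX y\<in>Y. h y + 2 * (t k x y + ?T \<theta> y)))"
    using insert.hyps fin
    by (simp add: average_swap[of S "I \<rightarrow>\<^sub>E S"] average_add average_const algebra_simps)
  finally show ?case
    unfolding average_PiE_insert[OF insert.hyps(2)] upd .
qed

text \<open>The restriction to \<open>J\<close> keeps sign vectors extensional.\<close>

definition negate :: "'a set \<Rightarrow> ('a \<Rightarrow> real) \<Rightarrow> 'a \<Rightarrow> real" where
  "negate J x = (\<lambda>j\<in>J. - x j)"

lemma bij_negate: "bij_betw (negate J) (signs J) (signs J)"
proof (rule bij_betw_byWitness[where f' = "negate J"])
  show "\<forall>x\<in>signs J. negate J (negate J x) = x" "\<forall>x\<in>signs J. negate J (negate J x) = x"
    by (auto simp: negate_def fun_eq_iff PiE_def extensional_def)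
  show "negate J ` signs J \<subseteq> signs J" "negate J ` signs J \<subseteq> signs J"
    by (auto simp: negate_def PiE_iff)
qed

lemma average_coordinate_sign:
  assumes "j \<in> J"
  shows "average (signs J) (\<lambda>x. x j * c) = 0"
proof -
  have "average (signs J) (\<lambda>x. x j * c) = average (signs J) (\<lambda>x. negate J x j * c)"
    by (rule average_bij[OF bij_negate, symmetric])
  also have "\<dots> = - average (signs J) (\<lambda>x. x j * c)"
    using assms by (simp add: negate_def average_def sum_negf)
  finally show ?thesis by simp
qed

lemma average_abs_signed_column:
  assumes "finite I" "finite J" "j \<in> J"
  shows "average (I \<rightarrow>\<^sub>E signs J) (\<lambda>\<theta>. \<bar>\<Sum>i\<in>I. \<theta> i j * a i\<bar>) \<le> sqrt (\<Sum>i\<in>I. (a i)\<^sup>2)"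
proof -
  have "average (signs J) (\<lambda>x. (x j * c)\<^sup>2) = c\<^sup>2" for c
  proof -
    have "(x j * c)\<^sup>2 = c\<^sup>2" if "x \<in> signs J" for x
      using PiE_mem[OF that assms(3)] by auto
    then have "average (signs J) (\<lambda>x. (x j * c)\<^sup>2) = average (signs J) (\<lambda>x. c\<^sup>2)"
      by (rule average_cong)
    then show ?thesis
      using assms by (simp add: average_const signs_finite_nonempty)
  qed
  then have "average (I \<rightarrow>\<^sub>E signs J) (\<lambda>\<theta>. (\<Sum>i\<in>I. \<theta> i j * a i)\<^sup>2) = (\<Sum>i\<in>I. (a i)\<^sup>2)"
    using average_square_independent_sum[of I "signs J" "\<lambda>i x. x j * a i"] assms
    by (simp add: signs_finite_nonempty average_coordinate_sign)
  then show ?thesis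
    using average_abs_le_sqrt[of "I \<rightarrow>\<^sub>E signs J" "\<lambda>\<theta>. \<Sum>i\<in>I. \<theta> i j * a i"]
    by simp
qed

text \<open>
  The form \<open>\<Sum>\<^sub>j x\<^sub>j a\<^sub>i\<^sub>j y\<^sub>j\<close> in the random row \<open>x\<close> has the second moment \<open>\<Sum>\<^sub>j a\<^sub>i\<^sub>j\<^sup>2\<close> for
  every sign vector \<open>y\<close>, which is the uniform bound on the means that the comparison requires.
\<close>

lemma average_inf_one_norm_le:
  assumes I: "finite I" and J: "finite J"
  shows "average (I \<rightarrow>\<^sub>E signs J) (\<lambda>\<theta>. inf_one_norm I J (\<lambda>i j. \<theta> i j * a i j))
    \<le> (\<Sum>i\<in>I. sqrt (\<Sum>j\<in>J. (a i j)\<^sup>2)) + 2 * (\<Sum>j\<in>J. sqrt (\<Sum>i\<in>I. (a i j)\<^sup>2))"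
proof -
  let ?R = "I \<rightarrow>\<^sub>E signs J"
  define t where "t i x y = (\<Sum>j\<in>J. x j * (a i j * y j))" for i and x y :: "'b \<Rightarrow> real"
  have row: "average (signs J) (\<lambda>x. \<bar>t i x y\<bar>) \<le> sqrt (\<Sum>j\<in>J. (a i j)\<^sup>2)" if y: "y \<in> signs J" for i y
  proof -
    have "(a i j * y j)\<^sup>2 = (a i j)\<^sup>2" if "j \<in> J" for j
      using PiE_mem[OF y that] by auto
    then show ?thesis
      using average_abs_le_sqrt[of "signs J" "\<lambda>x. t i x y"] J
      by (simp add: t_def average_square_signed_sum)
  qed
  have "average ?R (\<lambda>\<theta>. inf_one_norm I J (\<lambda>i j. \<theta> i j * a i j))
      = average ?R (\<lambda>\<theta>. MAX y\<in>signs J. 0 + (\<Sum>i\<in>I. \<bar>t i (\<theta> i) y\<bar>))"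
    by (simp add: inf_one_norm_def t_def mult_ac)
  also have "\<dots> \<le> (\<Sum>i\<in>I. sqrt (\<Sum>j\<in>J. (a i j)\<^sup>2))
      + average ?R (\<lambda>\<theta>. MAX y\<in>signs J. 0 + 2 * (\<Sum>i\<in>I. t i (\<theta> i) y))"
    by (intro average_Max_sum_abs_le[OF _ _ _ _ bij_negate] row I signs_finite_nonempty J)
      (simp_all add: t_def negate_def sum_negf)
  also have "average ?R (\<lambda>\<theta>. MAX y\<in>signs J. 0 + 2 * (\<Sum>i\<in>I. t i (\<theta> i) y))
      \<le> average ?R (\<lambda>\<theta>. 2 * (\<Sum>j\<in>J. \<bar>\<Sum>i\<in>I. \<theta> i j * a i j\<bar>))"
  proof (rule average_mono)
    fix \<theta>
    have "(\<Sum>i\<in>I. t i (\<theta> i) y) \<le> (\<Sum>j\<in>J. \<bar>\<Sum>i\<in>I. \<theta> i j * a i j\<bar>)" if y: "y \<in> signs J" for y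
    proof -
      have "(\<Sum>i\<in>I. t i (\<theta> i) y) = (\<Sum>j\<in>J. y j * (\<Sum>i\<in>I. \<theta> i j * a i j))"
        unfolding t_def sum_distrib_left by (subst sum.swap) (simp add: mult_ac)
      also have "\<dots> \<le> (\<Sum>j\<in>J. \<bar>\<Sum>i\<in>I. \<theta> i j * a i j\<bar>)"
        by (rule abs_le_D1[OF signed_sum_le_sum_abs[OF y]])
      finally show ?thesis .
    qed
    then show "(MAX y\<in>signs J. 0 + 2 * (\<Sum>i\<in>I. t i (\<theta> i) y))
        \<le> 2 * (\<Sum>j\<in>J. \<bar>\<Sum>i\<in>I. \<theta> i j * a i j\<bar>)"
      using J by (intro Max.boundedI) (auto simp: signs_finite_nonempty)
  qed
  also have "\<dots> = 2 * (\<Sum>j\<in>J. average ?R (\<lambda>\<theta>. \<bar>\<Sum>i\<in>I. \<theta> i j * a i j\<bar>))"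
    by (simp add: average_cmult average_sum)
  also have "\<dots> \<le> 2 * (\<Sum>j\<in>J. sqrt (\<Sum>i\<in>I. (a i j)\<^sup>2))"
    by (intro mult_left_mono sum_mono average_abs_signed_column I J) auto
  finally show ?thesis by simp
qed

section \<open>Rademacher functions and sign vectors\<close>

lemma rademacher_in_pair: "rademacher i u \<in> {-1, 1}"
  using abs_rademacher[of i u] by auto

text \<open>
  The first \<open>n\<close> Rademacher functions read off the first \<open>n\<close> binary digits. The value of the next
  one selects the left or the right half of the dyadic interval found so far.
\<close>

lemma rademacher_realises_signs:
  assumes "\<And>i. i \<in> {1..n} \<Longrightarrow> x i \<in> {-1, 1 :: real}"
  obtains k :: nat where "k < 2 ^ n"
    "\<And>u i. real k / 2 ^ n \<le> u \<Longrightarrow> u < (real k + 1) / 2 ^ n \<Longrightarrow> i \<in> {1..n} \<Longrightarrow> rademacher i u = x i"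
proof -
  have "\<exists>k < 2 ^ n. \<forall>u i. real k / 2 ^ n \<le> u \<longrightarrow> u < (real k + 1) / 2 ^ n \<longrightarrow> i \<in> {1..n}
      \<longrightarrow> rademacher i u = x i"
    using assms
  proof (induction n)
    case 0
    then show ?case by (intro exI[of _ 0]) auto
  next
    case (Suc n)
    from Suc.prems have "x i \<in> {-1, 1}" if "i \<in> {1..n}" for i
      using that by simp
    from Suc.IH[OF this] obtain k :: nat where k: "k < 2 ^ n"
      "\<And>u i. real k / 2 ^ n \<le> u \<Longrightarrow> u < (real k + 1) / 2 ^ n \<Longrightarrow> i \<in> {1..n} \<Longrightarrow> rademacher i u = x i"
      by blast
    define l where "l = 2 * k + (if x (Suc n) = 1 then 0 else 1)"
    have "rademacher i u = x i"
      if u: "real l / 2 ^ Suc n \<le> u" "u < (real l + 1) / 2 ^ Suc n" and i: "i \<in> {1..Suc n}" for u i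
    proof (cases "i = Suc n")
      case True
      have "\<lfloor>2 ^ Suc n * u\<rfloor> = int l"
        using u by (intro floor_unique) (auto simp: field_simps)
      then have "rademacher (Suc n) u = (-1) ^ l"
        unfolding rademacher_def by (simp only: power_int_of_nat)
      also have "\<dots> = x (Suc n)"
        using Suc.prems[of "Suc n"] by (auto simp: l_def)
      finally show ?thesis using True by simp
    next
      case False
      have "2 * real k \<le> real l" "real l + 1 \<le> 2 * real k + 2"
        by (auto simp: l_def)
      from this[THEN divide_right_mono, of "2 ^ Suc n"]
      have "real k / 2 ^ n \<le> real l / 2 ^ Suc n"
        "(real l + 1) / 2 ^ Suc n \<le> (real k + 1) / 2 ^ n"
        by (simp_all add: add_divide_distrib)
      then show ?thesis
        using u i False by (intro k(2)) auto
    qed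
    moreover have "l < 2 ^ Suc n"
      using k(1) by (simp add: l_def)
    ultimately show ?case by blast
  qed
  then show ?thesis using that by blast
qed

lemma signed_sum_eq:
  "signed_sum n m a \<theta> (u, v) =
    (\<Sum>i=1..n. rademacher i u * (\<Sum>j=1..m. rademacher j v * (\<theta> i j * a i j)))"
  unfolding signed_sum_def tensor_def by (simp add: sum_distrib_left mult_ac)

text \<open>
  The upper bound holds at every point. For the lower bound, the maximising signs are
  attained on an open dyadic rectangle, and a nonempty open set is not a null set.
\<close>

lemma Linf_norm_signed_sum_eq:
  "Linf_norm unit_square (signed_sum n m a \<theta>)
    = inf_one_norm {1..n} {1..m} (\<lambda>i j. \<theta> i j * a i j)"
proof (rule antisym)
  let ?b = "\<lambda>i j. \<theta> i j * a i j"
  let ?f = "signed_sum n m a \<theta>"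
  let ?N = "inf_one_norm {1..n} {1..m} ?b"
  have "\<bar>?f (u, v)\<bar> \<le> ?N" for u v
  proof -
    let ?x = "\<lambda>i\<in>{1..n}. rademacher i u" and ?y = "\<lambda>j\<in>{1..m}. rademacher j v"
    have x: "?x \<in> signs {1..n}" and y: "?y \<in> signs {1..m}"
      using rademacher_in_pair by (auto simp del: insert_iff)
    have "\<bar>?f (u, v)\<bar> = \<bar>\<Sum>i=1..n. ?x i * (\<Sum>j=1..m. ?y j * ?b i j)\<bar>"
      unfolding signed_sum_eq by simp
    also have "\<dots> \<le> (\<Sum>i=1..n. \<bar>\<Sum>j=1..m. ?y j * ?b i j\<bar>)"
      by (rule signed_sum_le_sum_abs[OF x])
    also have "\<dots> \<le> ?N"
      by (rule inf_one_norm_ge[OF _ y]) simp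
    finally show ?thesis .
  qed
  moreover have "(\<lambda>z. ereal \<bar>?f z\<bar>) \<in> borel_measurable unit_square"
    using signed_sum_measurable by measurable
  ultimately have "ereal (Linf_norm unit_square ?f) \<le> ereal ?N"
    unfolding Linf_norm_signed_sum by (intro esssup_I) auto
  then show "Linf_norm unit_square ?f \<le> ?N" by simp
next
  let ?b = "\<lambda>i j. \<theta> i j * a i j"
  let ?f = "signed_sum n m a \<theta>"
  let ?N = "inf_one_norm {1..n} {1..m} ?b"
  obtain y where y: "y \<in> signs {1..m}" "?N = (\<Sum>i=1..n. \<bar>\<Sum>j=1..m. y j * ?b i j\<bar>)"
    by (rule inf_one_norm_attained[OF finite_atLeastAtMost])
  obtain x where x: "x \<in> signs {1..n}"
    "(\<Sum>i=1..n. \<bar>\<Sum>j=1..m. y j * ?b i j\<bar>) = (\<Sum>i=1..n. x i * (\<Sum>j=1..m. y j * ?b i j))"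
    by (rule sum_abs_attained)
  obtain k where k: "k < 2 ^ n" "\<And>u i. real k / 2 ^ n \<le> u \<Longrightarrow> u < (real k + 1) / 2 ^ n
      \<Longrightarrow> i \<in> {1..n} \<Longrightarrow> rademacher i u = x i"
    using rademacher_realises_signs[of n x] PiE_mem[OF x(1)] by blast
  obtain l where l: "l < 2 ^ m" "\<And>v j. real l / 2 ^ m \<le> v \<Longrightarrow> v < (real l + 1) / 2 ^ m
      \<Longrightarrow> j \<in> {1..m} \<Longrightarrow> rademacher j v = y j"
    using rademacher_realises_signs[of m y] PiE_mem[OF y(1)] by blast
  define B where "B = {real k / 2 ^ n <..< (real k + 1) / 2 ^ n}
    \<times> {real l / 2 ^ m <..< (real l + 1) / 2 ^ m}"
  have fB: "\<bar>?f z\<bar> = ?N" if "z \<in> B" for z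
  proof -
    obtain u v where z: "z = (u, v)" by fastforce
    have "?f z = ?N"
      unfolding z signed_sum_eq y(2) x(2) using that k(2)[of u] l(2)[of v] by (simp add: B_def z)
    moreover have "?N \<ge> 0"
      unfolding y(2) by (intro sum_nonneg) auto
    ultimately show ?thesis by simp
  qed
  have kl: "real k + 1 \<le> 2 ^ n" "real l + 1 \<le> 2 ^ m"
    using k(1) l(1) by (metis Suc_leI of_nat_Suc of_nat_le_iff of_nat_numeral of_nat_power add.commute)+
  have "(real k + 1) / 2 ^ n \<le> 1" "(real l + 1) / 2 ^ m \<le> 1"
    "0 \<le> real k / 2 ^ n" "0 \<le> real l / 2 ^ m"
    using kl by simp_all
  then have B_sub: "B \<subseteq> {0..1} \<times> {0..1}"
    unfolding B_def by (intro Sigma_mono greaterThanLessThan_subseteq_atLeastAtMost_iff[THEN iffD2]) auto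
  have "real k / 2 ^ n < (real k + 1) / 2 ^ n" "real l / 2 ^ m < (real l + 1) / 2 ^ m"
    by (intro divide_strict_right_mono; simp)+
  then have B: "open B" "B \<noteq> {}"
    unfolding B_def by (simp_all add: open_Times)
  have sq: "({0..1} \<times> {0..1} :: (real \<times> real) set) \<in> sets lebesgue"
    by (intro lmeasurable_compact[THEN fmeasurableD] compact_Times compact_Icc)
  show "?N \<le> Linf_norm unit_square ?f"
  proof (rule ccontr)
    assume small: "\<not> ?N \<le> Linf_norm unit_square ?f"
    have "AE z in unit_square. ereal \<bar>?f z\<bar> \<le> ereal (Linf_norm unit_square ?f)"
      unfolding Linf_norm_signed_sum by (rule esssup_AE)
    then have "AE z in lebesgue. z \<in> {0..1} \<times> {0..1} \<longrightarrow> \<bar>?f z\<bar> \<le> Linf_norm unit_square ?f"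
      using sq by (simp add: AE_restrict_space_iff)
    then have "AE z in lebesgue. z \<notin> B"
      by (rule eventually_mono) (use fB B_sub small in auto)
    then have "B \<in> null_sets lebesgue"
      using B(1) by (subst AE_iff_null_sets) auto
    then show False
      using open_not_negligible[OF B] by (simp add: negligible_iff_null_sets)
  qed
qed

section \<open>The two-sided estimate\<close>

text \<open>Changing signs of the entries leaves the Euclidean norms of rows and columns unchanged.\<close>

lemma inf_one_norm_signs_lower:
  assumes "\<theta> \<in> sign_arrays n m"
  shows "9/16 * mixed_norm n m a \<le> inf_one_norm {1..n} {1..m} (\<lambda>i j. \<theta> i j * a i j)"
proof -
  let ?b = "\<lambda>i j. \<theta> i j * a i j"
  have sq: "(?b i j)\<^sup>2 = (a i j)\<^sup>2" if "i \<in> {1..n}" "j \<in> {1..m}" for i j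
    using PiE_mem[OF PiE_mem[OF assms[unfolded sign_arrays_def] that(1)] that(2)] by auto
  have "9/16 * (\<Sum>i=1..n. sqrt (\<Sum>j=1..m. (a i j)\<^sup>2)) \<le> inf_one_norm {1..n} {1..m} ?b"
    using inf_one_norm_lower[of "{1..n}" "{1..m}" ?b] sq by simp
  moreover have "9/16 * (\<Sum>j=1..m. sqrt (\<Sum>i=1..n. (a i j)\<^sup>2)) \<le> inf_one_norm {1..n} {1..m} ?b"
    using inf_one_norm_lower[of "{1..m}" "{1..n}" "\<lambda>j i. ?b i j"] sq
      inf_one_norm_le_transpose[of "{1..m}" "{1..n}" "\<lambda>j i. ?b i j"] by simp
  ultimately show ?thesis
    unfolding mixed_norm_def by (simp add: max_def)
qed

theorem theorem2:
  shows "\<exists>c C :: real. 0 < c \<and> c \<le> C \<and>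
    (\<forall>(n :: nat) (m :: nat) (a :: nat \<Rightarrow> nat \<Rightarrow> real).
       let Q = mixed_norm n m a;
           E = expectation_signs n m (\<lambda>\<theta>. Linf_norm unit_square (signed_sum n m a \<theta>));
           M = Min ((\<lambda>\<theta>. Linf_norm unit_square (signed_sum n m a \<theta>)) ` sign_arrays n m)
       in c * Q \<le> E \<and> E \<le> C * Q \<and> c * Q \<le> M \<and> M \<le> C * Q)"
proof -
  have "9/16 * mixed_norm n m a
        \<le> expectation_signs n m (\<lambda>\<theta>. Linf_norm unit_square (signed_sum n m a \<theta>))
      \<and> expectation_signs n m (\<lambda>\<theta>. Linf_norm unit_square (signed_sum n m a \<theta>))
        \<le> 3 * mixed_norm n m a
      \<and> 9/16 * mixed_norm n m a
        \<le> Min ((\<lambda>\<theta>. Linf_norm unit_square (signed_sum n m a \<theta>)) ` sign_arrays n m)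
      \<and> Min ((\<lambda>\<theta>. Linf_norm unit_square (signed_sum n m a \<theta>)) ` sign_arrays n m)
        \<le> 3 * mixed_norm n m a"
    for n m :: nat and a :: "nat \<Rightarrow> nat \<Rightarrow> real"
  proof -
    let ?A = "sign_arrays n m" and ?Q = "mixed_norm n m a"
    let ?F = "\<lambda>\<theta>. Linf_norm unit_square (signed_sum n m a \<theta>)"
    have A: "finite ?A" "?A \<noteq> {}"
      using finite_sign_arrays by (auto simp: sign_arrays_def PiE_eq_empty_iff)
    have E: "expectation_signs n m ?F = average ?A ?F"
      by (simp add: expectation_signs_def average_def)
    have lower: "9/16 * ?Q \<le> ?F \<theta>" if "\<theta> \<in> ?A" for \<theta>
      unfolding Linf_norm_signed_sum_eq by (rule inf_one_norm_signs_lower[OF that])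
    have "average ?A ?F \<le> (\<Sum>i=1..n. sqrt (\<Sum>j=1..m. (a i j)\<^sup>2))
        + 2 * (\<Sum>j=1..m. sqrt (\<Sum>i=1..n. (a i j)\<^sup>2))"
      unfolding Linf_norm_signed_sum_eq sign_arrays_def by (intro average_inf_one_norm_le) auto
    also have "\<dots> \<le> 3 * ?Q"
      unfolding mixed_norm_def by linarith
    finally have upper: "average ?A ?F \<le> 3 * ?Q" .
    have "Min (?F ` ?A) \<le> average ?A ?F"
      using A by (intro const_le_average) auto
    moreover have "9/16 * ?Q \<le> average ?A ?F"
      using A lower by (intro const_le_average)
    moreover have "9/16 * ?Q \<le> Min (?F ` ?A)"
      using A lower by (intro Min.boundedI) auto
    ultimately show ?thesis
      unfolding E using upper by linarith
  qed
  then have "\<forall>n m a. let Q = mixed_norm n m a;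
           E = expectation_signs n m (\<lambda>\<theta>. Linf_norm unit_square (signed_sum n m a \<theta>));
           M = Min ((\<lambda>\<theta>. Linf_norm unit_square (signed_sum n m a \<theta>)) ` sign_arrays n m)
       in 9/16 * Q \<le> E \<and> E \<le> 3 * Q \<and> 9/16 * Q \<le> M \<and> M \<le> 3 * Q"
    unfolding Let_def by (intro allI)
  moreover have "(0::real) < 9/16" "9/16 \<le> (3::real)"
    by simp_all
  ultimately show ?thesis
    by (intro exI[of _ "9/16"] exI[of _ 3] conjI)
qed

end
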